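(* Let $q$ be a prime power and let $n,t,u,r,l,k_1,k,d_0,d_1$ be integers with $t,r\ge 0$, $k_1=n-l-r\ge 1$, $k=k_1+l$, $q\le u\le n$, and $u\le q+d_0-3$. Assume there is an $[n,k]_q$ code $\mathcal{C}$ of minimum distance $d_1\ge 2t+1$ with a $k\times n$ generator matrix of the form $$\boldsymbol{G}=\begin{bmatrix}\boldsymbol{G}_1\\ \boldsymbol{H}_0\end{bmatrix},\qquad \boldsymbol{G}_1=\begin{bmatrix}\boldsymbol{0}_{k_1\times l} & \boldsymbol{I}_{k_1} & \boldsymbol{P}_{k_1\times r}\end{bmatrix},$$ where $\boldsymbol{P}\in\mathbb{F}_q^{k_1\times r}$, $\boldsymbol{G}_1$ is a $k_1\times n$ generator matrix of an $[n,k_1]_q$ code $\mathcal{C}_1$, and $\boldsymbol{H}_0$ is a systematic $l\times n$ parity-check matrix (its first $l$ columns form $\boldsymbol{I}_l$) of an $[n,k_1+r,d_0]_q$ code $\mathcal{C}_0$ (so $d_0\ge u-q+3$). Then this code, with the encoder and decoder described below, is a $(u,t)$-PSMC for partially-stuck-at-$1$ cells with message space $\mathbb{F}_q^{k_1}$: it masks any $u$ partially-stuck-at-$1$ cells and corrects any $t$ additional errors while storing $k_1=n-r-l$ information symbols. Encoder: given $\boldsymbol{m}\in\mathbb{F}_q^{k_1}$ and the set $\boldsymbol{\phi}=\{\phi_0,\dots,\phi_{u-1}\}\subseteq\{0,\dots,n-1\}$ of partially stuck positions, compute $\boldsymbol{w}=\boldsymbol{m}\boldsymbol{G}_1$, find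 $\boldsymbol{z}=(z_0,\dots,z_{l-1})\in\mathbb{F}_q^l$ such that $\boldsymbol{c}=\boldsymbol{w}+\boldsymbol{z}\boldsymbol{H}_0$ satisfies $c_{\phi_i}\ne 0$ for all $i$ (such a $\boldsymbol{z}$ always exists), and output $\boldsymbol{c}$. Decoder: given $\boldsymbol{y}=\boldsymbol{c}+\boldsymbol{e}$, decode $\boldsymbol{y}$ in $\mathcal{C}$ to the codeword $\hat{\boldsymbol{c}}$ (unique codeword within Hamming distance $t$), let $\hat{\boldsymbol{z}}=(\hat c_0,\dots,\hat c_{l-1})$, compute $\hat{\boldsymbol{w}}=(\hat w_0,\dots,\hat w_{n-1})=\hat{\boldsymbol{c}}-\hat{\boldsymbol{z}}\boldsymbol{H}_0$, and output $\hat{\boldsymbol{m}}=(\hat w_l,\hat w_{l+1},\dots,\hat w_{n-r-1})$.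
   Context: $\mathbb{F}_q$ is the finite field with $q$ elements; its elements are identified with the memory levels $0,1,\dots,q-1$, with the field's zero element corresponding to level $0$. All arithmetic is in $\mathbb{F}_q$. Positions of vectors of length $n$ are indexed $0,\dots,n-1$. An $[n,k,d]_q$ code is a linear code over $\mathbb{F}_q$ of length $n$, dimension $k$ and minimum Hamming distance $d$. $\boldsymbol{0}_{a\times b}$ is the all-zero matrix and $\boldsymbol{I}_a$ is the identity matrix. A memory cell is partially stuck at level $s$ if it can store only values that are at least $s$; thus a cell partially stuck at level $1$ can store exactly the nonzero elements of $\mathbb{F}_q$. A $(u,t)$-PSMC (partially-stuck-at-masking code) of length $n$ for partially-stuck-at-$1$ cells, with message space $\mathcal{M}$, is a pair (encoder, decoder). The encoder takes as input any set $\boldsymbol{\phi}=\{\phi_0,\dots,\phi_{u-1}\}\subseteq\{0,\dots,n-1\}$ of $u$ positions (all partially stuck at level $1$) and any message $\boldsymbol{m}\in\mathcal{M}$, and outputs $\boldsymbol{c}\in\mathbb{F}_q^n$ with $c_{\phi_i}\ge 1$ (i.e. $c_{\phi_i}\neq 0$) for all $i=0,\dots,u-1$. The decoder, which does not know $\boldsymbol{\phi}$, takes as input $\boldsymbol{c}+\boldsymbol{e}$ and returns the correct message $\boldsymbol{m}$ for every error vector $\boldsymbol{e}\in\mathbb{F}_q^n$ of Hamming weight at most $t$. *)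

theory Defs
  imports "HOL-Library.Cardinality" "Jordan_Normal_Form.VS_Connect" "Jordan_Normal_Form.Matrix_Kernel"
begin

text \<open>The field with \<open>q\<close> elements is a type \<open>'a :: {field,finite}\<close> with \<open>q = CARD('a)\<close>.
  A row vector times a matrix, \<open>x A\<close>, is written \<open>A\<^sup>T *\<^sub>v x\<close>.\<close>

definition hamming_dist :: "'a vec \<Rightarrow> 'a vec \<Rightarrow> nat" where
  "hamming_dist x y = card {i. i < dim_vec x \<and> x $ i \<noteq> y $ i}"

definition hamming_weight :: "'a :: zero vec \<Rightarrow> nat" where
  "hamming_weight x = card {i. i < dim_vec x \<and> x $ i \<noteq> 0}"

text \<open>Meaningful only for finite codes with at least two codewords, since \<open>Min {}\<close> is unspecified.\<close>

definition min_distance :: "'a vec set \<Rightarrow> nat" where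
  "min_distance C = Min {hamming_dist x y | x y. x \<in> C \<and> y \<in> C \<and> x \<noteq> y}"

definition linear_code :: "nat \<Rightarrow> nat \<Rightarrow> 'a :: field vec set \<Rightarrow> bool" where
  "linear_code n k C \<longleftrightarrow>
     subspace class_ring C (module_vec TYPE('a) n) \<and>
     vectorspace.dim class_ring ((module_vec TYPE('a) n)\<lparr>carrier := C\<rparr>) = k"

text \<open>As the \<open>k\<close> rows span a space of dimension \<open>k\<close>, they are automatically linearly independent;
  likewise a parity-check matrix with \<open>n - k\<close> rows automatically has full rank.\<close>

definition generator_matrix :: "nat \<Rightarrow> nat \<Rightarrow> 'a :: field mat \<Rightarrow> 'a vec set \<Rightarrow> bool" where
  "generator_matrix n k G C \<longleftrightarrow>
     linear_code n k C \<and> G \<in> carrier_mat k n \<and> vec_space.row_space n G = C"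

definition parity_check_matrix :: "nat \<Rightarrow> nat \<Rightarrow> 'a :: field mat \<Rightarrow> 'a vec set \<Rightarrow> bool" where
  "parity_check_matrix n k H C \<longleftrightarrow>
     linear_code n k C \<and> H \<in> carrier_mat (n - k) n \<and> mat_kernel H = C"

definition systematic :: "'a :: {zero,one} mat \<Rightarrow> bool" where
  "systematic H \<longleftrightarrow> dim_row H \<le> dim_col H \<and>
     mat (dim_row H) (dim_row H) (\<lambda>(i, j). H $$ (i, j)) = 1\<^sub>m (dim_row H)"

definition append_cols :: "'a :: zero mat \<Rightarrow> 'a mat \<Rightarrow> 'a mat" (infixr \<open>@\<^sub>c\<close> 65) where
  "A @\<^sub>c B = four_block_mat A B (0\<^sub>m 0 (dim_col A)) (0\<^sub>m 0 (dim_col B))"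

text \<open>An identification of the field elements with the memory levels \<open>0, \<dots>, q - 1\<close>.\<close>

definition level_map :: "('a :: {field,finite} \<Rightarrow> nat) \<Rightarrow> bool" where
  "level_map lev \<longleftrightarrow> bij_betw lev UNIV {0..<CARD('a)} \<and> lev 0 = 0"

definition storable :: "('a \<Rightarrow> nat) \<Rightarrow> nat \<Rightarrow> 'a \<Rightarrow> bool" where
  "storable lev s x \<longleftrightarrow> s \<le> lev x"

definition psmc ::
  "('a :: {field,finite} \<Rightarrow> nat) \<Rightarrow> nat \<Rightarrow> nat \<Rightarrow> nat \<Rightarrow> 'm set \<Rightarrow>
   (nat set \<Rightarrow> 'm \<Rightarrow> 'a vec) \<Rightarrow> ('a vec \<Rightarrow> 'm) \<Rightarrow> bool" where
  "psmc lev n u t M enc dec \<longleftrightarrow>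
     (\<forall>\<phi> m. \<phi> \<subseteq> {..<n} \<longrightarrow> card \<phi> = u \<longrightarrow> m \<in> M \<longrightarrow>
        enc \<phi> m \<in> carrier_vec n \<and>
        (\<forall>i\<in>\<phi>. storable lev 1 (enc \<phi> m $ i)) \<and>
        (\<forall>e \<in> carrier_vec n. hamming_weight e \<le> t \<longrightarrow> dec (enc \<phi> m + e) = m))"

definition masking_vector ::
  "'a :: field mat \<Rightarrow> 'a mat \<Rightarrow> nat set \<Rightarrow> 'a vec \<Rightarrow> 'a vec \<Rightarrow> bool" where
  "masking_vector G\<^sub>1 H\<^sub>0 \<phi> m z \<longleftrightarrow>
     z \<in> carrier_vec (dim_row H\<^sub>0) \<and>
     (\<forall>i\<in>\<phi>. (transpose_mat G\<^sub>1 *\<^sub>v m + transpose_mat H\<^sub>0 *\<^sub>v z) $ i \<noteq> 0)"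

text \<open>The search for \<open>z\<close> may be carried out in any way: a search procedure is an arbitrary
  function that returns a masking vector whenever there is one.\<close>

definition masking_search ::
  "nat \<Rightarrow> nat \<Rightarrow> 'a :: field mat \<Rightarrow> 'a mat \<Rightarrow> (nat set \<Rightarrow> 'a vec \<Rightarrow> 'a vec) \<Rightarrow> bool" where
  "masking_search n u G\<^sub>1 H\<^sub>0 find_z \<longleftrightarrow>
     (\<forall>\<phi> m. \<phi> \<subseteq> {..<n} \<longrightarrow> card \<phi> = u \<longrightarrow> m \<in> carrier_vec (dim_row G\<^sub>1) \<longrightarrow>
        (\<exists>z. masking_vector G\<^sub>1 H\<^sub>0 \<phi> m z) \<longrightarrow> masking_vector G\<^sub>1 H\<^sub>0 \<phi> m (find_z \<phi> m))"

definition encoder ::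
  "'a :: field mat \<Rightarrow> 'a mat \<Rightarrow> (nat set \<Rightarrow> 'a vec \<Rightarrow> 'a vec) \<Rightarrow> nat set \<Rightarrow> 'a vec \<Rightarrow> 'a vec" where
  "encoder G\<^sub>1 H\<^sub>0 find_z \<phi> m =
     (let w = transpose_mat G\<^sub>1 *\<^sub>v m; z = find_z \<phi> m in w + transpose_mat H\<^sub>0 *\<^sub>v z)"

definition decoder ::
  "nat \<Rightarrow> nat \<Rightarrow> nat \<Rightarrow> nat \<Rightarrow> 'a :: field vec set \<Rightarrow> 'a mat \<Rightarrow> 'a vec \<Rightarrow> 'a vec" where
  "decoder n l r t C H\<^sub>0 y =
     (let c = (THE c. c \<in> C \<and> hamming_dist y c \<le> t);
          z = vec l (\<lambda>i. c $ i);
          w = c - transpose_mat H\<^sub>0 *\<^sub>v z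
      in vec (n - r - l) (\<lambda>i. w $ (l + i)))"

end

(* The encoder adds to w = m G_1 a codeword z H_0 of the dual of C_0, so masking means finding z with
   z . h_i \<noteq> -w_i for all i in phi, where h_i is the i-th column of H_0.  Any d_0 - 1 columns are
   linearly independent.  Fix the values z . h_i arbitrarily (different from -w_i) on d_0 - 2 of the
   stuck positions; the solutions form a translate of a subspace W on which each of the at most q - 1
   remaining functionals z . h_i is nonzero, so each of them excludes exactly |W| / q solutions
   and together they cannot exclude all of them. *)
theory Submission
  imports Defs
begin

lemma finite_carrier_vec_finite [simp]: "finite (carrier_vec n :: 'a :: finite vec set)"
proof -
  have "carrier_vec n \<subseteq> vec_of_list ` {xs :: 'a list. set xs \<subseteq> UNIV \<and> length xs = n}"
  proof
    fix v :: "'a vec" assume "v \<in> carrier_vec n"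
    then have "v = vec_of_list (list_of_vec v)" "length (list_of_vec v) = n"
      by (auto simp: vec_list)
    then show "v \<in> vec_of_list ` {xs :: 'a list. set xs \<subseteq> UNIV \<and> length xs = n}" by blast
  qed
  then show ?thesis
    by (rule finite_subset) (intro finite_imageI finite_lists_length_eq finite)
qed

subsection \<open>Hamming distance\<close>

text \<open>\<open>hamming_dist\<close> ranges over the indices of its first argument only, hence
  the hypothesis on the lengths.\<close>

lemma hamming_dist_commute:
  assumes "dim_vec x = dim_vec y"
  shows "hamming_dist x y = hamming_dist y x"
  using assms unfolding hamming_dist_def by (auto intro: arg_cong[where f = card])

lemma hamming_dist_triangle:
  assumes "dim_vec x = dim_vec y"
  shows "hamming_dist x z \<le> hamming_dist x y + hamming_dist y z"
proof -
  have "hamming_dist x z \<le> card ({i. i < dim_vec x \<and> x $ i \<noteq> y $ i} \<union> {i. i < dim_vec y \<and> y $ i \<noteq> z $ i})"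
    unfolding hamming_dist_def by (rule card_mono) (use assms in auto)
  also have "\<dots> \<le> hamming_dist x y + hamming_dist y z"
    unfolding hamming_dist_def by (rule card_Un_le)
  finally show ?thesis .
qed

lemma min_distance_le:
  assumes "finite C" "x \<in> C" "y \<in> C" "x \<noteq> y"
  shows "min_distance C \<le> hamming_dist x y"
proof -
  have "{hamming_dist x y | x y. x \<in> C \<and> y \<in> C \<and> x \<noteq> y} \<subseteq> (\<lambda>(x, y). hamming_dist x y) ` (C \<times> C)"
    by auto
  then have "finite {hamming_dist x y | x y. x \<in> C \<and> y \<in> C \<and> x \<noteq> y}"
    by (rule finite_subset) (use assms in auto)
  then show ?thesis
    unfolding min_distance_def by (rule Min_le) (use assms in blast)
qed

text \<open>Two codewords within distance \<open>t\<close> of \<open>y\<close> are within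
  \<open>2 * t\<close> of each other, hence equal.\<close>

lemma bounded_distance_decoding_unique:
  assumes "finite C" "C \<subseteq> carrier_vec n" "2 * t + 1 \<le> min_distance C"
    and "c \<in> C" "y \<in> carrier_vec n" "hamming_dist y c \<le> t"
  shows "(THE c. c \<in> C \<and> hamming_dist y c \<le> t) = c"
proof (rule the_equality)
  show "c \<in> C \<and> hamming_dist y c \<le> t" using assms by simp
next
  fix c' assume c': "c' \<in> C \<and> hamming_dist y c' \<le> t"
  show "c' = c"
  proof (rule ccontr)
    assume "c' \<noteq> c"
    then have "min_distance C \<le> hamming_dist c' c"
      using min_distance_le assms c' by blast
    also have "\<dots> \<le> hamming_dist c' y + hamming_dist y c"
      by (rule hamming_dist_triangle) (use assms c' in auto)
    also have "hamming_dist c' y = hamming_dist y c'"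
      by (rule hamming_dist_commute) (use assms c' in auto)
    finally show False using assms c' by linarith
  qed
qed

text \<open>Kernel vectors are the linear dependencies between the columns of \<open>H\<close>, so
  this is the independence of any family of columns smaller than the minimum distance: a nonzero
  dependency would be a codeword too close to the zero word.\<close>

lemma kernel_vector_of_small_support:
  fixes H :: "'a :: {field,finite} mat"
  assumes H: "H \<in> carrier_mat l n" and A: "A \<subseteq> {..<n}" "card A < min_distance (mat_kernel H)"
    and x: "x \<in> mat_kernel H" "\<And>i. i < n \<Longrightarrow> i \<notin> A \<Longrightarrow> x $ i = 0"
  shows "x = 0\<^sub>v n"
proof (rule ccontr)
  assume "x \<noteq> 0\<^sub>v n"
  have sub: "mat_kernel H \<subseteq> carrier_vec n" using mat_kernel_carrier[OF H] .
  then have xc: "x \<in> carrier_vec n" using x(1) by blast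
  then have "min_distance (mat_kernel H) \<le> hamming_dist x (0\<^sub>v n)"
    using H x \<open>x \<noteq> 0\<^sub>v n\<close>
    by (intro min_distance_le finite_subset[OF sub]) (auto simp: mat_kernel[OF H])
  also have "\<dots> \<le> card A"
    unfolding hamming_dist_def
  proof (rule card_mono)
    show "finite A" using A(1) finite_subset by blast
    have "i \<in> A" if "i < n" "x $ i \<noteq> 0" for i using x(2) that by blast
    then show "{i. i < dim_vec x \<and> x $ i \<noteq> 0\<^sub>v n $ i} \<subseteq> A" using xc by auto
  qed
  finally show False using A by simp
qed

subsection \<open>Avoiding affine hyperplanes\<close>

text \<open>Finite-dimensional duality: a functional vanishing on the common zeros of the columns in
  \<open>A\<close> is a combination of them, with coefficient vector \<open>x\<close> supported on
  \<open>A\<close>. The induction eliminates one column at a time.\<close>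

lemma separate_or_in_column_span:
  fixes H :: "'a :: field mat"
  assumes H: "H \<in> carrier_mat l n" and "finite A" "A \<subseteq> {..<n}" and h: "h \<in> carrier_vec l"
    and "\<And>z. z \<in> carrier_vec l \<Longrightarrow> \<forall>j\<in>A. col H j \<bullet> z = 0 \<Longrightarrow> h \<bullet> z = 0"
  shows "\<exists>x\<in>carrier_vec n. (\<forall>i<n. i \<notin> A \<longrightarrow> x $ i = 0) \<and> H *\<^sub>v x = h"
  using assms(2,3,4,5)
proof (induction A arbitrary: h rule: finite_induct)
  case empty
  have "h = 0\<^sub>v l"
  proof (rule eq_vecI)
    fix i assume "i < dim_vec (0\<^sub>v l :: 'a vec)"
    then show "h $ i = 0\<^sub>v l $ i" using empty.prems(3)[of "unit_vec l i"] empty.prems(2) by auto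
  qed (use empty in auto)
  then show ?case using H by (intro bexI[of _ "0\<^sub>v n"]) auto
next
  case (insert b A)
  have b: "b < n" and hc: "col H b \<in> carrier_vec l" using insert.prems H by auto
  show ?case
  \<comment> \<open>If column \<open>b\<close> already vanishes on the common zeros of the columns
    in \<open>A\<close>, it adds no constraint and the induction hypothesis applies to
    \<open>h\<close> itself.\<close>
  proof (cases "\<forall>z\<in>carrier_vec l. (\<forall>j\<in>A. col H j \<bullet> z = 0) \<longrightarrow> col H b \<bullet> z = 0")
    case True
    have "\<exists>x\<in>carrier_vec n. (\<forall>i<n. i \<notin> A \<longrightarrow> x $ i = 0) \<and> H *\<^sub>v x = h"
      by (rule insert.IH) (use insert.prems True in simp_all)
    then show ?thesis by auto
  next
    case False
    then obtain v where v: "v \<in> carrier_vec l" "\<forall>j\<in>A. col H j \<bullet> v = 0" "col H b \<bullet> v \<noteq> 0"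
      by auto
    \<comment> \<open>This multiple makes \<open>h - s \<cdot>\<^sub>v col H b\<close> vanish at
      \<open>v\<close>.\<close>
    define s where "s = (h \<bullet> v) / (col H b \<bullet> v)"
    have "\<exists>x\<in>carrier_vec n. (\<forall>i<n. i \<notin> A \<longrightarrow> x $ i = 0) \<and> H *\<^sub>v x = h - s \<cdot>\<^sub>v col H b"
    proof (rule insert.IH)
      fix z assume z: "z \<in> carrier_vec l" "\<forall>j\<in>A. col H j \<bullet> z = 0"
      \<comment> \<open>Moving \<open>z\<close> along \<open>v\<close> by this amount reaches a zero
        of column \<open>b\<close> and keeps the equations for \<open>A\<close>, so the hypothesis
        on \<open>h\<close> applies there.\<close>
      define c where "c = (col H b \<bullet> z) / (col H b \<bullet> v)"
      have "h \<bullet> (z - c \<cdot>\<^sub>v v) = 0"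
      proof (rule insert.prems(3), goal_cases)
        case 2
        show ?case
        proof
          fix j assume "j \<in> insert b A"
          moreover have "col H j \<bullet> (z - c \<cdot>\<^sub>v v) = col H j \<bullet> z - c * (col H j \<bullet> v)" if "j < n"
            using z(1) v(1) H that by (subst scalar_prod_minus_distrib[of _ l]) auto
          ultimately show "col H j \<bullet> (z - c \<cdot>\<^sub>v v) = 0"
            using insert.prems(1) z(2) v(2,3) by (auto simp: c_def)
        qed
      qed (use z v in auto)
      moreover have "h \<bullet> (z - c \<cdot>\<^sub>v v) = h \<bullet> z - c * (h \<bullet> v)"
        using z(1) v(1) insert.prems(2) by (subst scalar_prod_minus_distrib[of _ l]) auto
      moreover have "(h - s \<cdot>\<^sub>v col H b) \<bullet> z = h \<bullet> z - s * (col H b \<bullet> z)"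
        using z(1) hc insert.prems(2) by (subst minus_scalar_prod_distrib[of _ l]) auto
      ultimately show "(h - s \<cdot>\<^sub>v col H b) \<bullet> z = 0" by (simp add: c_def s_def)
    qed (use insert.prems hc in auto)
    then obtain x where x: "x \<in> carrier_vec n" "\<forall>i<n. i \<notin> A \<longrightarrow> x $ i = 0"
      "H *\<^sub>v x = h - s \<cdot>\<^sub>v col H b" by auto
    \<comment> \<open>The removed multiple of column \<open>b\<close> returns as the coefficient in
      position \<open>b\<close>.\<close>
    have "H *\<^sub>v (x + s \<cdot>\<^sub>v unit_vec n b) = H *\<^sub>v x + s \<cdot>\<^sub>v (H *\<^sub>v unit_vec n b)"
      using H x(1) by (simp add: mult_add_distrib_mat_vec[OF H] mult_mat_vec[OF H])
    also have "H *\<^sub>v unit_vec n b = col H b"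
      using H b by (intro eq_vecI) auto
    also have "H *\<^sub>v x + s \<cdot>\<^sub>v col H b = h"
      unfolding x(3) using H hc insert.prems(2) by (intro eq_vecI) auto
    finally show ?thesis using x b by (intro bexI[of _ "x + s \<cdot>\<^sub>v unit_vec n b"]) auto
  qed
qed

text \<open>Otherwise duality would put column \<open>a\<close> in the span of the columns in
  \<open>A\<close>, against independence. Scaling gives the value 1.\<close>

lemma separating_functional:
  fixes H :: "'a :: field mat"
  assumes H: "H \<in> carrier_mat l n" and A: "finite A" "insert a A \<subseteq> {..<n}" "a \<notin> A"
    and indep: "\<And>x. x \<in> mat_kernel H \<Longrightarrow> (\<And>i. i < n \<Longrightarrow> i \<notin> insert a A \<Longrightarrow> x $ i = 0) \<Longrightarrow> x = 0\<^sub>v n"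
  shows "\<exists>v\<in>carrier_vec l. (\<forall>j\<in>A. col H j \<bullet> v = 0) \<and> col H a \<bullet> v = 1"
proof -
  have a: "a < n" and ha: "col H a \<in> carrier_vec l" using A H by auto
  have "\<exists>z\<in>carrier_vec l. (\<forall>j\<in>A. col H j \<bullet> z = 0) \<and> col H a \<bullet> z \<noteq> 0"
  proof (rule ccontr)
    assume "\<not> ?thesis"
    then have "\<exists>x\<in>carrier_vec n. (\<forall>i<n. i \<notin> A \<longrightarrow> x $ i = 0) \<and> H *\<^sub>v x = col H a"
      using A(2) by (intro separate_or_in_column_span[OF H A(1) _ ha]) auto
    then obtain x where x: "x \<in> carrier_vec n" "\<forall>i<n. i \<notin> A \<longrightarrow> x $ i = 0" "H *\<^sub>v x = col H a"
      by auto
    \<comment> \<open>The expansion of column \<open>a\<close> yields a dependency supported on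
      \<open>insert a A\<close> with entry -1 at \<open>a\<close>.\<close>
    have "H *\<^sub>v (x - unit_vec n a) = H *\<^sub>v x - H *\<^sub>v unit_vec n a"
      using x(1) by (simp add: mult_minus_distrib_mat_vec[OF H])
    also have "H *\<^sub>v unit_vec n a = col H a"
      using H a by (intro eq_vecI) auto
    finally have "x - unit_vec n a \<in> mat_kernel H"
      using x ha by (intro mat_kernelI[OF H]) auto
    then have "x - unit_vec n a = 0\<^sub>v n"
      by (rule indep) (use x a in auto)
    then have "(x - unit_vec n a) $ a = 0" using a by simp
    then show False using x A(3) a by simp
  qed
  then obtain z where z: "z \<in> carrier_vec l" "\<forall>j\<in>A. col H j \<bullet> z = 0" "col H a \<bullet> z \<noteq> 0" by auto
  have "col H j \<bullet> ((1 / (col H a \<bullet> z)) \<cdot>\<^sub>v z) = (col H j \<bullet> z) / (col H a \<bullet> z)" if "j < n" for j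
    using z(1) H that by (subst scalar_prod_smult_distrib[of _ l]) auto
  then show ?thesis
    using z A(2) by (intro bexI[of _ "(1 / (col H a \<bullet> z)) \<cdot>\<^sub>v z"]) auto
qed

text \<open>As in Newton interpolation, positions are added one by one: the correction along a
  vector that is zero on the earlier columns and 1 on the new one keeps all earlier values.\<close>

lemma interpolation_on_independent_columns:
  fixes H :: "'a :: field mat"
  assumes H: "H \<in> carrier_mat l n" and A: "finite A" "A \<subseteq> {..<n}"
    and indep: "\<And>x. x \<in> mat_kernel H \<Longrightarrow> (\<And>i. i < n \<Longrightarrow> i \<notin> A \<Longrightarrow> x $ i = 0) \<Longrightarrow> x = 0\<^sub>v n"
  shows "\<exists>z\<in>carrier_vec l. \<forall>j\<in>A. col H j \<bullet> z = b j"
  using A indep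
proof (induction A rule: finite_induct)
  case empty
  show ?case by (intro bexI[of _ "0\<^sub>v l"]) auto
next
  case (insert a A)
  have "\<exists>z\<in>carrier_vec l. \<forall>j\<in>A. col H j \<bullet> z = b j"
    by (rule insert.IH) (use insert.prems in auto)
  then obtain z where z: "z \<in> carrier_vec l" "\<forall>j\<in>A. col H j \<bullet> z = b j" by auto
  obtain v where v: "v \<in> carrier_vec l" "\<forall>j\<in>A. col H j \<bullet> v = 0" "col H a \<bullet> v = 1"
    using separating_functional[OF H insert.hyps(1) insert.prems(1) insert.hyps(2) insert.prems(2)] by auto
  define s where "s = b a - col H a \<bullet> z"
  have "col H j \<bullet> (z + s \<cdot>\<^sub>v v) = col H j \<bullet> z + s * (col H j \<bullet> v)" if "j < n" for j
    using z(1) v(1) H that by (subst scalar_prod_add_distrib[of _ l]) auto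
  then show ?case
    using z v insert.prems(1) by (intro bexI[of _ "z + s \<cdot>\<^sub>v v"]) (auto simp: s_def)
qed

text \<open>Shifting by the multiples of a vector on which the functional is 1 partitions the solution
  set into \<open>CARD('a)\<close> translates of the hyperplane.\<close>

lemma card_hyperplane_section:
  fixes h v :: "'a :: {field,finite} vec"
  assumes W: "W \<subseteq> carrier_vec l" "\<And>w s. w \<in> W \<Longrightarrow> w + s \<cdot>\<^sub>v v \<in> W"
    and h: "h \<in> carrier_vec l" and v: "v \<in> carrier_vec l" "h \<bullet> v = 1"
  shows "card {w \<in> W. h \<bullet> w = c} * CARD('a) \<le> card W"
proof -
  let ?S = "{w \<in> W. h \<bullet> w = c}"
  let ?f = "\<lambda>(w, s). w + s \<cdot>\<^sub>v v"
  \<comment> \<open>The functional takes the value \<open>c + s\<close> at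
    \<open>w + s \<cdot>\<^sub>v v\<close>, so a sum determines \<open>s\<close> and then
    \<open>w\<close>.\<close>
  have "inj_on ?f (?S \<times> UNIV)"
  proof (rule inj_onI, clarify)
    fix w s w' s'
    assume w: "w \<in> W" "w' \<in> W" "c = h \<bullet> w" "h \<bullet> w' = h \<bullet> w"
      and eq: "w + s \<cdot>\<^sub>v v = w' + s' \<cdot>\<^sub>v v"
    have cv: "w \<in> carrier_vec l" "w' \<in> carrier_vec l" using w W by auto
    have "h \<bullet> (w + s \<cdot>\<^sub>v v) = h \<bullet> w + s" "h \<bullet> (w' + s' \<cdot>\<^sub>v v) = h \<bullet> w' + s'"
      using cv h v by (simp_all add: scalar_prod_add_distrib[of _ l])
    then have s: "s = s'" using eq w by simp
    have "w = w'"
    proof (rule eq_vecI)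
      fix i assume i: "i < dim_vec w'"
      then have "(w + s \<cdot>\<^sub>v v) $ i = (w' + s' \<cdot>\<^sub>v v) $ i" by (simp only: eq)
      then show "w $ i = w' $ i" using s i cv v by simp
    qed (use cv in auto)
    then show "w = w' \<and> s = s'" using s by simp
  qed
  then have "card (?S \<times> (UNIV :: 'a set)) = card (?f ` (?S \<times> UNIV))"
    by (simp add: card_image)
  also have "\<dots> \<le> card W"
    by (rule card_mono) (use W finite_subset[OF W(1)] in auto)
  finally show ?thesis by (simp add: card_cartesian_product)
qed

lemma exists_avoiding_vector:
  fixes H :: "'a :: {field,finite} mat"
  assumes H: "H \<in> carrier_mat l n" and \<phi>: "\<phi> \<subseteq> {..<n}"
    and d: "2 \<le> min_distance (mat_kernel H)" "card \<phi> + 3 \<le> CARD('a) + min_distance (mat_kernel H)"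
  shows "\<exists>z\<in>carrier_vec l. \<forall>i\<in>\<phi>. col H i \<bullet> z \<noteq> b i"
proof -
  let ?d = "min_distance (mat_kernel H)"
  have fin: "finite \<phi>" using \<phi> finite_subset by blast
  have q: "0 < CARD('a)" by (rule zero_less_card_finite)
  \<comment> \<open>Fixing \<open>?d - 2\<close> values, not \<open>?d - 1\<close>, keeps
    \<open>A\<close> independent together with any one further column. The minimum covers the case
    of fewer stuck positions.\<close>
  obtain A where A: "A \<subseteq> \<phi>" "card A = min (?d - 2) (card \<phi>)"
    using obtain_subset_with_card_n[of "min (?d - 2) (card \<phi>)" \<phi>] by auto
  have finA: "finite A" and An: "A \<subseteq> {..<n}" using A fin \<phi> finite_subset by blast+
  have indep: "x = 0\<^sub>v n"
    if "B \<subseteq> {..<n}" "card B < ?d" "x \<in> mat_kernel H" "\<And>i. i < n \<Longrightarrow> i \<notin> B \<Longrightarrow> x $ i = 0" for B x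
    using kernel_vector_of_small_support[OF H] that by blast
  \<comment> \<open>\<open>b j + 1\<close> serves as a value different from
    \<open>b j\<close>.\<close>
  define W where "W = {z \<in> carrier_vec l. \<forall>j\<in>A. col H j \<bullet> z = b j + 1}"
  have finW: "finite W" unfolding W_def by simp
  have "\<exists>z\<in>carrier_vec l. \<forall>j\<in>A. col H j \<bullet> z = b j + 1"
    by (rule interpolation_on_independent_columns[OF H finA An])
      (use indep[OF An] A(2) d(1) in auto)
  then have "card W > 0" using finW by (auto simp: W_def card_gt_0_iff)
  have excluded: "card {w \<in> W. col H i \<bullet> w = b i} * CARD('a) \<le> card W" if i: "i \<in> \<phi> - A" for i
  proof -
    \<comment> \<open>At most \<open>?d - 1\<close> columns are involved, so some direction changes
      column \<open>i\<close> while staying inside \<open>W\<close>.\<close>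
    have "card (insert i A) < ?d" using i finA A(2) d(1) by auto
    moreover have iA: "insert i A \<subseteq> {..<n}" using i \<phi> An by auto
    ultimately have "\<exists>v\<in>carrier_vec l. (\<forall>j\<in>A. col H j \<bullet> v = 0) \<and> col H i \<bullet> v = 1"
      using separating_functional[OF H finA iA _ indep[OF iA]] i by blast
    then obtain v where v: "v \<in> carrier_vec l" "\<forall>j\<in>A. col H j \<bullet> v = 0" "col H i \<bullet> v = 1"
      by blast
    show ?thesis
    proof (rule card_hyperplane_section[where l = l and v = v])
      fix w s assume w: "w \<in> W"
      have "col H j \<bullet> (w + s \<cdot>\<^sub>v v) = col H j \<bullet> w + s * (col H j \<bullet> v)" if "j < n" for j
        using w v(1) H that by (subst scalar_prod_add_distrib[of _ l]) (auto simp: W_def)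
      then show "w + s \<cdot>\<^sub>v v \<in> W" using w v An by (auto simp: W_def)
    qed (use v H iA in \<open>auto simp: W_def\<close>)
  qed
  let ?U = "\<Union>i\<in>\<phi> - A. {w \<in> W. col H i \<bullet> w = b i}"
  \<comment> \<open>Either \<open>A\<close> is all of \<open>\<phi>\<close>, or exactly
    \<open>card \<phi> - (?d - 2)\<close> positions remain, which is at most
    \<open>CARD('a) - 1\<close>.\<close>
  have "card (\<phi> - A) < CARD('a)"
    using card_Diff_subset[OF finA A(1)] A(2) d q by linarith
  \<comment> \<open>Union bound, multiplied by the field size to avoid division.\<close>
  have "card ?U * CARD('a) \<le> (\<Sum>i\<in>\<phi> - A. card {w \<in> W. col H i \<bullet> w = b i}) * CARD('a)"
    by (intro mult_right_mono card_UN_le) (use fin in auto)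
  also have "\<dots> \<le> card (\<phi> - A) * card W"
    unfolding sum_distrib_right using sum_bounded_above[of "\<phi> - A", OF excluded] by simp
  also have "\<dots> < CARD('a) * card W"
    using \<open>card (\<phi> - A) < CARD('a)\<close> \<open>card W > 0\<close> by simp
  finally have "card ?U < card W" by (simp add: mult.commute)
  then have "\<not> W \<subseteq> ?U" using card_mono[of ?U W] fin finW by fastforce
  then obtain z where z: "z \<in> W" "z \<notin> ?U" by blast
  have "col H i \<bullet> z \<noteq> b i" if "i \<in> \<phi>" for i
    using z that by (cases "i \<in> A") (auto simp: W_def)
  then show ?thesis using z(1) by (auto simp: W_def)
qed

subsection \<open>Encoding and decoding\<close>

text \<open>Encoding with stacked generators adds the two separate encodings; this places the masked
  word in the big code.\<close>

lemma transpose_append_rows_mult: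
  fixes A B :: "'a :: comm_semiring_0 mat"
  assumes "A \<in> carrier_mat a n" "B \<in> carrier_mat b n" "x \<in> carrier_vec a" "y \<in> carrier_vec b"
  shows "transpose_mat (A @\<^sub>r B) *\<^sub>v (x @\<^sub>v y) = transpose_mat A *\<^sub>v x + transpose_mat B *\<^sub>v y"
proof (rule eq_vecI)
  fix i assume "i < dim_vec (transpose_mat A *\<^sub>v x + transpose_mat B *\<^sub>v y)"
  then have i: "i < n" using assms by simp
  have "col (A @\<^sub>r B) i = col A i @\<^sub>v col B i"
    using assms i by (intro eq_vecI) (auto simp: append_rows_def)
  then have "col (A @\<^sub>r B) i \<bullet> (x @\<^sub>v y) = col A i \<bullet> x + col B i \<bullet> y"
    using assms i by (simp add: scalar_prod_append[of _ a _ b])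
  then show "(transpose_mat (A @\<^sub>r B) *\<^sub>v (x @\<^sub>v y)) $ i = (transpose_mat A *\<^sub>v x + transpose_mat B *\<^sub>v y) $ i"
    using assms i by (simp add: append_rows_def)
qed (use assms in \<open>auto simp: append_rows_def\<close>)

text \<open>The zero block leaves the first \<open>l\<close> positions free for the masking vector,
  and the identity block shows the message right after them.\<close>

lemma transpose_zero_identity_mult:
  fixes P :: "'a :: comm_semiring_1 mat" and l :: nat
  assumes P: "P \<in> carrier_mat k r" and m: "m \<in> carrier_vec k"
  defines "G \<equiv> 0\<^sub>m k l @\<^sub>c 1\<^sub>m k @\<^sub>c P"
  shows "i < l \<Longrightarrow> (transpose_mat G *\<^sub>v m) $ i = 0"
    and "i < k \<Longrightarrow> (transpose_mat G *\<^sub>v m) $ (l + i) = m $ i"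
proof -
  have dim: "G \<in> carrier_mat k (l + (k + r))"
    using P by (auto simp: G_def append_cols_def)
  have left: "col G i = 0\<^sub>v k" if "i < l" for i
    using P that by (intro eq_vecI) (auto simp: G_def append_cols_def)
  have mid: "col G (l + i) = unit_vec k i" if "i < k" for i
    using P that by (intro eq_vecI) (auto simp: G_def append_cols_def)
  show "i < l \<Longrightarrow> (transpose_mat G *\<^sub>v m) $ i = 0" using dim m left by auto
  show "i < k \<Longrightarrow> (transpose_mat G *\<^sub>v m) $ (l + i) = m $ i" using dim m mid by auto
qed

text \<open>The first \<open>l\<close> columns are unit vectors, so the masking vector can be read
  off without knowing the stuck positions.\<close>

lemma transpose_systematic_mult:
  fixes H :: "'a :: comm_semiring_1 mat"
  assumes "systematic H" "H \<in> carrier_mat l n" "z \<in> carrier_vec l" "i < l"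
  shows "(transpose_mat H *\<^sub>v z) $ i = z $ i"
proof -
  have "H $$ (j, i) = (1\<^sub>m l :: 'a mat) $$ (j, i)" if "j < l" for j
  proof -
    have "mat l l (\<lambda>(i, j). H $$ (i, j)) $$ (j, i) = (1\<^sub>m l :: 'a mat) $$ (j, i)"
      using assms by (simp add: systematic_def)
    then show ?thesis using that assms by simp
  qed
  then have "col H i = unit_vec l i"
    using assms by (intro eq_vecI) (auto simp: systematic_def)
  then show ?thesis using assms by (simp add: systematic_def)
qed


theorem theorem4:
  fixes q n t u r l k\<^sub>1 k d\<^sub>0 d\<^sub>1 :: nat
    and C C\<^sub>0 C\<^sub>1 :: "'a :: {field,finite} vec set"
    and G G\<^sub>1 H\<^sub>0 P :: "'a mat"
    and lev :: "'a \<Rightarrow> nat"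
    and find_z :: "nat set \<Rightarrow> 'a vec \<Rightarrow> 'a vec"
  assumes "q = CARD('a)" and "level_map lev"
    and "n = k\<^sub>1 + l + r" and "k\<^sub>1 \<ge> 1" and "k = k\<^sub>1 + l"
    and "q \<le> u" and "u \<le> n" and "u + 3 \<le> q + d\<^sub>0"
    and "linear_code n k C" and "min_distance C = d\<^sub>1" and "d\<^sub>1 \<ge> 2 * t + 1"
    and "generator_matrix n k G C" and "G = G\<^sub>1 @\<^sub>r H\<^sub>0"
    and "P \<in> carrier_mat k\<^sub>1 r" and "G\<^sub>1 = 0\<^sub>m k\<^sub>1 l @\<^sub>c 1\<^sub>m k\<^sub>1 @\<^sub>c P"
    and "linear_code n k\<^sub>1 C\<^sub>1" and "generator_matrix n k\<^sub>1 G\<^sub>1 C\<^sub>1"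
    and "linear_code n (k\<^sub>1 + r) C\<^sub>0" and "min_distance C\<^sub>0 = d\<^sub>0"
    and "H\<^sub>0 \<in> carrier_mat l n" and "parity_check_matrix n (k\<^sub>1 + r) H\<^sub>0 C\<^sub>0" and "systematic H\<^sub>0"
    and "masking_search n u G\<^sub>1 H\<^sub>0 find_z"
  shows "(\<forall>\<phi> m. \<phi> \<subseteq> {..<n} \<longrightarrow> card \<phi> = u \<longrightarrow> m \<in> carrier_vec k\<^sub>1 \<longrightarrow>
            (\<exists>z. masking_vector G\<^sub>1 H\<^sub>0 \<phi> m z)) \<and>
         psmc lev n u t (carrier_vec k\<^sub>1)
           (encoder G\<^sub>1 H\<^sub>0 find_z) (decoder n l r t C H\<^sub>0)"
proof (intro conjI)
  have G1: "G\<^sub>1 \<in> carrier_mat k\<^sub>1 n"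
    using assms(17) by (simp add: generator_matrix_def)
  note H0 = assms(20)
  have C0: "mat_kernel H\<^sub>0 = C\<^sub>0" using assms(21) by (simp add: parity_check_matrix_def)
  show ex: "\<forall>\<phi> m. \<phi> \<subseteq> {..<n} \<longrightarrow> card \<phi> = u \<longrightarrow> m \<in> carrier_vec k\<^sub>1 \<longrightarrow>
      (\<exists>z. masking_vector G\<^sub>1 H\<^sub>0 \<phi> m z)"
  proof (intro allI impI)
    fix \<phi> :: "nat set" and m :: "'a vec"
    assume \<phi>: "\<phi> \<subseteq> {..<n}" "card \<phi> = u" and m: "m \<in> carrier_vec k\<^sub>1"
    \<comment> \<open>The forbidden value at \<open>i\<close> is the one that cancels the entry of
      the unmasked word. From \<open>q \<le> u\<close> and \<open>u + 3 \<le> q + d\<^sub>0\<close>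
      follows \<open>d\<^sub>0 \<ge> 3\<close>, which gives the lower bound on the minimum
      distance.\<close>
    have "\<exists>z\<in>carrier_vec l. \<forall>i\<in>\<phi>. col H\<^sub>0 i \<bullet> z \<noteq> - (transpose_mat G\<^sub>1 *\<^sub>v m) $ i"
      by (rule exists_avoiding_vector[OF H0 \<phi>(1)]) (use assms(1,6,8,19) \<phi>(2) C0 in auto)
    then obtain z where z: "z \<in> carrier_vec l"
      "\<forall>i\<in>\<phi>. col H\<^sub>0 i \<bullet> z \<noteq> - (transpose_mat G\<^sub>1 *\<^sub>v m) $ i" by auto
    have "(transpose_mat G\<^sub>1 *\<^sub>v m + transpose_mat H\<^sub>0 *\<^sub>v z) $ i \<noteq> 0" if "i \<in> \<phi>" for i
    proof -
      have "i < n" using that \<phi> by auto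
      then have "(transpose_mat G\<^sub>1 *\<^sub>v m + transpose_mat H\<^sub>0 *\<^sub>v z) $ i
          = (transpose_mat G\<^sub>1 *\<^sub>v m) $ i + col H\<^sub>0 i \<bullet> z"
        using H0 G1 by simp
      then show ?thesis using z(2) that by (metis add_eq_0_iff)
    qed
    then show "\<exists>z. masking_vector G\<^sub>1 H\<^sub>0 \<phi> m z"
      using z(1) H0 by (auto simp: masking_vector_def)
  qed
  have G: "G \<in> carrier_mat k n" and rows: "vec_space.row_space n G = C"
    using assms(12) by (auto simp: generator_matrix_def)
  have C: "C = {w \<in> carrier_vec n. \<exists>y\<in>carrier_vec k. transpose_mat G *\<^sub>v y = w}"
    using vec_space.row_space_eq[OF G] rows G by auto
  show "psmc lev n u t (carrier_vec k\<^sub>1) (encoder G\<^sub>1 H\<^sub>0 find_z) (decoder n l r t C H\<^sub>0)"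
    unfolding psmc_def
  proof (intro allI impI)
    fix \<phi> :: "nat set" and m :: "'a vec"
    assume \<phi>: "\<phi> \<subseteq> {..<n}" "card \<phi> = u" and m: "m \<in> carrier_vec k\<^sub>1"
    define z where "z = find_z \<phi> m"
    define w where "w = transpose_mat G\<^sub>1 *\<^sub>v m"
    define c where "c = w + transpose_mat H\<^sub>0 *\<^sub>v z"
    have enc: "encoder G\<^sub>1 H\<^sub>0 find_z \<phi> m = c"
      by (simp add: encoder_def c_def w_def z_def)
    have mv: "masking_vector G\<^sub>1 H\<^sub>0 \<phi> m z"
      using assms(23) ex \<phi> m G1 unfolding masking_search_def z_def by auto
    have z: "z \<in> carrier_vec l" and nz: "\<forall>i\<in>\<phi>. c $ i \<noteq> 0"
      using mv H0 by (auto simp: masking_vector_def c_def w_def)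
    have w: "w \<in> carrier_vec n" using G1 m by (simp add: w_def)
    have c: "c \<in> carrier_vec n" using w H0 z by (simp add: c_def)
    \<comment> \<open>The masked word is the codeword of \<open>C\<close> with information vector
      \<open>m\<close> followed by \<open>z\<close>.\<close>
    have "transpose_mat G *\<^sub>v (m @\<^sub>v z) = c"
      using transpose_append_rows_mult[OF G1 H0 m z] assms(13) by (simp add: c_def w_def)
    then have cC: "c \<in> C" using m z c assms(5) unfolding C by (auto intro!: bexI[of _ "m @\<^sub>v z"])
    have "storable lev 1 (c $ i)" if "i \<in> \<phi>" for i
    proof -
      \<comment> \<open>Only the zero element has level 0, so a nonzero entry has level at least
        1.\<close>
      have "inj lev" "lev 0 = 0" using assms(2) by (auto simp: level_map_def bij_betw_def)
      then have "lev (c $ i) \<noteq> 0" using nz that by (metis injD)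
      then show ?thesis by (simp add: storable_def)
    qed
    moreover have "decoder n l r t C H\<^sub>0 (c + e) = m"
      if e: "e \<in> carrier_vec n" "hamming_weight e \<le> t" for e
    proof -
      \<comment> \<open>The received word differs from \<open>c\<close> exactly on the support of
        \<open>e\<close>.\<close>
      have "hamming_dist (c + e) c = hamming_weight e"
        unfolding hamming_dist_def hamming_weight_def
        using c e by (intro arg_cong[where f = card]) auto
      then have the: "(THE c'. c' \<in> C \<and> hamming_dist (c + e) c' \<le> t) = c"
        using assms(10,11) c cC e C
        by (intro bounded_distance_decoding_unique[where n = n]) auto
      \<comment> \<open>On the first \<open>l\<close> positions \<open>w\<close> is zero and the
        mask coincides with \<open>z\<close>.\<close>
      have ze: "vec l (\<lambda>i. c $ i) = z"
      proof (rule eq_vecI)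
        fix i assume "i < dim_vec z"
        then have i: "i < l" using z by simp
        then have "w $ i = 0"
          unfolding w_def assms(15) using transpose_zero_identity_mult(1)[OF assms(14) m] by blast
        then show "vec l (\<lambda>i. c $ i) $ i = z $ i"
          using transpose_systematic_mult[OF assms(22) H0 z i] i w H0 assms(3) by (simp add: c_def)
      qed (use z in auto)
      have we: "c - transpose_mat H\<^sub>0 *\<^sub>v z = w"
        using w H0 by (intro eq_vecI) (auto simp: c_def)
      \<comment> \<open>The window starts after the \<open>l\<close> zero positions and has length
        \<open>n - r - l\<close>, which equals \<open>k\<^sub>1\<close>.\<close>
      have "vec (n - r - l) (\<lambda>i. w $ (l + i)) = m"
      proof (rule eq_vecI)
        fix i assume "i < dim_vec m"
        then have i: "i < k\<^sub>1" using m by simp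
        then have "w $ (l + i) = m $ i"
          unfolding w_def assms(15) using transpose_zero_identity_mult(2)[OF assms(14) m] by blast
        then show "vec (n - r - l) (\<lambda>i. w $ (l + i)) $ i = m $ i" using i assms(3) by simp
      qed (use m assms(3) in auto)
      then show ?thesis by (simp add: decoder_def Let_def the ze we)
    qed
    ultimately show "encoder G\<^sub>1 H\<^sub>0 find_z \<phi> m \<in> carrier_vec n \<and>
        (\<forall>i\<in>\<phi>. storable lev 1 (encoder G\<^sub>1 H\<^sub>0 find_z \<phi> m $ i)) \<and>
        (\<forall>e\<in>carrier_vec n. hamming_weight e \<le> t \<longrightarrow>
          decoder n l r t C H\<^sub>0 (encoder G\<^sub>1 H\<^sub>0 find_z \<phi> m + e) = m)"
      using c unfolding enc by blast
  qed
qed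

end
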